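(* Let $n \ge 5$ be an integer. Let $\mathcal{N}_{\min}$ be the minimum nullity among all quartic circulant graphs of order $n$, i.e. among the graphs $\mathrm{Circ}(n, \{p, q\})$ with integers $1 \le p < q < \frac{n}{2}$. Then the following hold. (1) If $n$ is odd, then $\mathcal{N}_{\min} = 0$; every $\mathrm{Circ}(n, \{p, q\})$ with $1 \le p < q < \frac{n}{2}$ attains it, and the corresponding null spaces are trivial. (2) If $n = 6$, then $\mathcal{N}_{\min} = 3$; it is attained by the graph with $p = 1$, $q = 2$ (which is the only quartic circulant graph of order $6$), and its null space is \[ \mathrm{span}\left( (1,0,0,-1,0,0)^{\mathrm T},\ (0,1,0,0,-1,0)^{\mathrm T},\ (0,0,1,0,0,-1)^{\mathrm T} \right). \] (3) If $n = 2^\alpha$ for some integer $\alpha \ge 3$, or $n = 3 \cdot 2^\alpha$ for some integer $\alpha \ge 2$, then $\mathcal{N}_{\min} = 1$; the graph $\mathrm{Circ}(n, \{p, q\})$, $1 \le p < q < \frac{n}{2}$, attains it if and only if $p \not\equiv q \pmod 2$ and $\gcd(n, p+q) = \gcd(n, q-p) = 1$, and the null space of each such graph is \[ \mathrm{span}\left( (1, -1, 1, -1, \ldots, 1, -1)^{\mathrm T} \right). \] (4) If $n = \beta \, 2^\alpha$ for some integers $\alpha \ge 1$ and $\beta \ge 5$ with $\beta$ odd, then $\mathcal{N}_{\min} = 0$; the graph $\mathrm{Circ}(n, \{p, q\})$, $1 \le p < q < \frac{n}{2}$, attains it if and only if $p = \gamma \, 2^{\alpha-1}$ and $q = \delta \,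 2^{\alpha-1}$ for some integers $1 \le \gamma < \delta < \beta$ with $\gamma \equiv \delta \pmod 2$, and the corresponding null spaces are trivial.
   Context: For an integer $n \ge 1$ and a set $S$ of integers $j$ with $1 \le j \le \frac{n}{2}$, $\mathrm{Circ}(n, S)$ denotes the circulant graph with vertex set $\{0, 1, \ldots, n-1\}$ in which two distinct vertices $i, k$ are adjacent if and only if $i - k \equiv s$ or $i - k \equiv -s \pmod n$ for some $s \in S$. The quartic ($4$-regular) circulant graphs of order $n$ are exactly the graphs $\mathrm{Circ}(n, \{p, q\})$ with $n \ge 5$ and $1 \le p < q < \frac{n}{2}$. The null space of a graph is the null space of its adjacency matrix (as a subspace of $\mathbb{R}^n$, coordinates indexed by the vertices $0, 1, \ldots, n-1$ in order), and its nullity is the dimension of this null space. *)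

theory Defs
  imports
    "Graph_Theory.Pair_Digraph"
    "Jordan_Normal_Form.Matrix_Kernel"
    "HOL-Number_Theory.Cong"
begin

text \<open>
  An undirected simple graph is a symmetric loop-free digraph without parallel arcs
  (locale \<^locale>\<open>pair_graph\<close>).
\<close>

definition Circ :: "nat \<Rightarrow> nat set \<Rightarrow> nat pair_pre_digraph" where
  "Circ n S = \<lparr> pverts = {0..<n},
     parcs = {(i, k). i \<in> {0..<n} \<and> k \<in> {0..<n} \<and> i \<noteq> k \<and>
       (\<exists>s\<in>S. [int i - int k = int s] (mod int n) \<or> [int i - int k = - int s] (mod int n))} \<rparr>"

lemma pair_graph_Circ: "pair_graph (Circ n S)"
proof -
  have fin: "finite (parcs (Circ n S))"
    by (rule finite_subset[of _ "{0..<n} \<times> {0..<n}"]) (auto simp: Circ_def)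
  have swap: "[b - a = - c] (mod m)" if "[a - b = c] (mod m)" for a b c m :: int
    using that by (metis cong_minus_minus_iff minus_diff_eq)
  have symm: "(k, i) \<in> parcs (Circ n S)" if "(i, k) \<in> parcs (Circ n S)" for i k
    using that swap[of "int i" "int k" _ "int n"] by (fastforce simp: Circ_def)
  show ?thesis
    by unfold_locales
       (use fin symm in \<open>auto simp: Circ_def symmetric_def intro!: symI\<close>)
qed

text \<open>The constraint \<open>2 * q < n\<close> is \<open>q < n / 2\<close> without truncating division.\<close>

definition quartic_circulants :: "nat \<Rightarrow> nat pair_pre_digraph set" where
  "quartic_circulants n = {Circ n {p, q} | p q. 1 \<le> p \<and> p < q \<and> 2 * q < n}"

text \<open>Meaningful only for graphs whose vertex set is \<open>{0..<m}\<close> for some \<open>m\<close>.\<close>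

definition adjacency_matrix :: "nat pair_pre_digraph \<Rightarrow> real mat" where
  "adjacency_matrix G = mat (card (pverts G)) (card (pverts G))
     (\<lambda>(i, k). if (i, k) \<in> parcs G then 1 else 0)"

definition null_space :: "nat pair_pre_digraph \<Rightarrow> real vec set" where
  "null_space G = mat_kernel (adjacency_matrix G)"

text \<open>
  \<^const>\<open>kernel_dim\<close> is the dimension of \<^const>\<open>mat_kernel\<close> as a vector space.
\<close>

definition nullity :: "nat pair_pre_digraph \<Rightarrow> nat" where
  "nullity G = kernel_dim (adjacency_matrix G)"

definition min_nullity :: "nat \<Rightarrow> nat" where
  "min_nullity n = Min (nullity ` quartic_circulants n)"

text \<open>For orders \<open>n \<ge> 5\<close> the minimum is over a finite nonempty set.\<close>

lemma finite_quartic_circulants: "finite (quartic_circulants n)"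
proof (rule finite_subset)
  show "quartic_circulants n \<subseteq> (\<lambda>(p, q). Circ n {p, q}) ` ({..n} \<times> {..n})"
    by (force simp: quartic_circulants_def)
qed auto

lemma quartic_circulants_nonempty: "n \<ge> 5 \<Longrightarrow> quartic_circulants n \<noteq> {}"
proof -
  assume "n \<ge> 5"
  then have "Circ n {1, 2} \<in> quartic_circulants n"
    unfolding quartic_circulants_def by (intro CollectI exI[of _ 1] exI[of _ 2]) auto
  then show ?thesis by blast
qed

abbreviation span_vec :: "nat \<Rightarrow> real vec set \<Rightarrow> real vec set" where
  "span_vec n \<equiv> LinearCombinations.module.span class_ring (module_vec TYPE(real) n)"

end

theory Submission
  imports Defs
begin

text \<open>
  With \<open>T\<close> the cyclic shift on \<open>n\<close>-periodic sequences, the adjacency operator factors as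
  \<open>T\<^sup>p + T\<^sup>-\<^sup>p + T\<^sup>q + T\<^sup>-\<^sup>q = T\<^sup>-\<^sup>q (T\<^sup>p\<^sup>+\<^sup>q + 1) (T\<^sup>q\<^sup>-\<^sup>p + 1)\<close>.
  Write \<open>n = \<beta> 2\<^sup>\<alpha>\<close> with \<open>\<beta>\<close> odd. If \<open>2\<^sup>\<alpha>\<close> divides \<open>c\<close>, then \<open>T\<^sup>c + 1\<close> is injective:
  \<open>\<beta>\<close> sign changes return to the start. Otherwise \<open>n / gcd n c\<close> is even, and the kernel of
  \<open>T\<^sup>c + 1\<close> consists of the sequences that change sign under a shift by \<open>gcd n c\<close>,
  a space of dimension \<open>gcd n c\<close>.
  Everything follows by reading this off for \<open>c = p + q\<close> and \<open>c = q - p\<close>.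
\<close>

section \<open>Linear algebra: independence, span and kernel dimension\<close>

text \<open>Reading a vanishing combination at an index where \<open>v\<close> alone is nonzero
  leaves only the term \<open>a v * v $ i\<close>, so \<open>a v = 0\<close>.\<close>

lemma (in vec_space) lin_indpt_if_private_index:
  assumes fin: "finite B" and B: "B \<subseteq> carrier_vec n"
    and sep: "\<And>v. v \<in> B \<Longrightarrow> \<exists>i<n. v $ i \<noteq> 0 \<and> (\<forall>w\<in>B - {v}. w $ i = 0)"
  shows "lin_indpt B"
proof (rule finite_lin_indpt2)
  fix a
  assume lc: "lincomb a B = 0\<^sub>v n"
  have "a v = 0" if v: "v \<in> B" for v
  proof -
    obtain i where i: "i < n" "v $ i \<noteq> 0" "\<forall>w\<in>B - {v}. w $ i = 0"
      using sep[OF v] by blast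
    have "0 = lincomb a B $ i" using lc i(1) by simp
    also have "\<dots> = (\<Sum>w\<in>B. a w * w $ i)" using lincomb_index[OF i(1) B] .
    also have "\<dots> = a v * v $ i + (\<Sum>w\<in>B - {v}. a w * w $ i)"
      using sum.remove[OF fin v] .
    also have "(\<Sum>w\<in>B - {v}. a w * w $ i) = 0" using i(3) by (intro sum.neutral) auto
    finally show ?thesis using i(2) by simp
  qed
  then show "\<forall>v\<in>B. a v = 0" by blast
qed (use fin B in auto)

lemma (in vec_space) in_spanI:
  assumes "finite B" "B \<subseteq> carrier_vec n" "v \<in> carrier_vec n"
    and "\<And>i. i < n \<Longrightarrow> v $ i = (\<Sum>w\<in>B. a w * w $ i)"
  shows "v \<in> span B"
proof -
  have "v = lincomb a B"
  proof (rule eq_vecI)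
    show "dim_vec v = dim_vec (lincomb a B)"
      using lincomb_dim[OF assms(1,2), of a] assms(3) by simp
    fix i assume "i < dim_vec (lincomb a B)"
    then have "i < n" using lincomb_dim[OF assms(1,2), of a] by simp
    then show "v $ i = lincomb a B $ i" using assms(4) lincomb_index[OF _ assms(2)] by simp
  qed
  then show ?thesis unfolding span_def using assms(1) by auto
qed

context kernel
begin

text \<open>Gauss-Jordan elimination multiplies \<open>A\<close> by an invertible \<open>P\<close>,
  which keeps the kernel, and the kernel of an echelon form has an explicit finite basis.\<close>

lemma kernel_fin_dim: "Ker.fin_dim"
proof -
  obtain P Q where PQ: "gauss_jordan_single A = P * A" "Q * P = 1\<^sub>m nr"
      "P \<in> carrier_mat nr nr" "Q \<in> carrier_mat nr nr"
    and C: "gauss_jordan_single A \<in> carrier_mat nr nc"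
    and row: "row_echelon_form (gauss_jordan_single A)"
    using gauss_jordan_single[OF A refl] by auto
  have ker: "mat_kernel (gauss_jordan_single A) = mat_kernel A"
    using mat_kernel_mult_eq[OF A PQ(3,4,2)] PQ(1) by simp
  have "basis (set (find_base_vectors (gauss_jordan_single A)))"
    using find_base_vectors(3)[OF row C] ker by simp
  then show ?thesis
    unfolding Ker.fin_dim_def Ker.basis_def by blast
qed

text \<open>Independence is tested in the ambient space \<open>NC\<close>;
  \<open>lindep_same\<close> transfers it to the kernel, where the dimension is counted.\<close>

lemma card_le_kernel_dim:
  assumes "B \<subseteq> mat_kernel A" "NC.lin_indpt B"
  shows "card B \<le> kernel_dim A"
  using Ker.li_le_dim(2)[OF kernel_fin_dim assms(1)] lindep_same[OF assms(1)] assms(2)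
  by simp

lemma kernel_dim_eq_card:
  assumes "finite B" "NC.lin_indpt B" "B \<subseteq> mat_kernel A" "mat_kernel A = NC.span B"
  shows "kernel_dim A = card B"
proof -
  have "basis B"
    unfolding Ker.basis_def using assms lindep_same[OF assms(3)] span_same[OF assms(3)] by simp
  then show ?thesis using Ker.dim_basis[OF assms(1)] by simp
qed

text \<open>A single nonzero kernel vector is already an independent set of size 1; conversely the
  empty set is a basis of the zero space.\<close>

lemma kernel_dim_eq_0_iff: "kernel_dim A = 0 \<longleftrightarrow> mat_kernel A = {0\<^sub>v nc}"
proof
  assume dim0: "kernel_dim A = 0"
  have "v = 0\<^sub>v nc" if v: "v \<in> mat_kernel A" for v
  proof (rule ccontr)
    assume nz: "v \<noteq> 0\<^sub>v nc"
    have vc: "v \<in> carrier_vec nc" using mat_kernelD(1)[OF A v] .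
    with nz obtain i where "i < nc" "v $ i \<noteq> 0" by (metis carrier_vecD eq_vecI index_zero_vec)
    then have "NC.lin_indpt {v}" using vc by (intro NC.lin_indpt_if_private_index) auto
    from card_le_kernel_dim[OF _ this] v dim0 show False by simp
  qed
  moreover have "0\<^sub>v nc \<in> mat_kernel A" using A by (intro mat_kernelI[OF A]) auto
  ultimately show "mat_kernel A = {0\<^sub>v nc}" by blast
next
  assume ker: "mat_kernel A = {0\<^sub>v nc}"
  have "kernel_dim A = card ({} :: 'a vec set)"
  proof (rule kernel_dim_eq_card)
    show "NC.lin_indpt {}" by (rule NC.lin_indpt_if_private_index) auto
    show "mat_kernel A = NC.span {}" using ker NC.span_empty by simp
  qed auto
  then show "kernel_dim A = 0" by simp
qed

end

section \<open>Periodic and antiperiodic sequences on the integers\<close>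

text \<open>Vectors become periodic sequences on all integers, so that the cyclic shift T is plain
  translation and indices need no reduction.\<close>

definition periodic_ext :: "nat \<Rightarrow> real vec \<Rightarrow> int \<Rightarrow> real" where
  "periodic_ext n v j = v $ nat (j mod int n)"

lemma periodic_ext_add_mult [simp]: "periodic_ext n v (j + k * int n) = periodic_ext n v j"
  by (simp add: periodic_ext_def)

lemma periodic_ext_of_nat: "i < n \<Longrightarrow> periodic_ext n v (int i) = v $ i"
  by (simp add: periodic_ext_def)

lemma periodic_ext_vec:
  assumes "n > 0" and per: "\<And>j k. h (j + k * int n) = h j"
  shows "periodic_ext n (vec n (\<lambda>i. h (int i))) j = h j"
proof -
  have "h j = h (j mod int n + (j div int n) * int n)" by simp
  also have "\<dots> = h (j mod int n)" by (rule per)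
  finally show ?thesis using assms(1) by (simp add: periodic_ext_def nat_less_iff)
qed

lemma antiperiodic_iterate:
  fixes f :: "int \<Rightarrow> real"
  assumes "\<And>j. f (j + c) = - f j"
  shows "f (j + int m * c) = (-1) ^ m * f j"
proof (induction m)
  case (Suc m)
  have "f (j + int (Suc m) * c) = f ((j + int m * c) + c)" by (simp add: algebra_simps)
  then show ?case using assms Suc by simp
qed simp

text \<open>With \<open>c = 2 ^ \<alpha> * k\<close> one has \<open>\<beta> * c = k * n\<close>. A
  shift by this amount changes nothing by periodicity and changes the sign because
  \<open>\<beta>\<close> is odd.\<close>

lemma antiperiodic_eq_0:
  fixes f :: "int \<Rightarrow> real"
  assumes per: "\<And>j k. f (j + k * int n) = f j" and anti: "\<And>j. f (j + c) = - f j"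
    and "n = \<beta> * 2 ^ \<alpha>" "odd \<beta>" "2 ^ \<alpha> dvd c"
  shows "f j = 0"
proof -
  from assms(5) obtain k where k: "c = 2 ^ \<alpha> * k" by (elim dvdE)
  have "f j = f (j + k * int n)" by (simp add: per)
  also have "k * int n = int \<beta> * c" by (simp add: k assms(3))
  also have "f (j + int \<beta> * c) = - f j"
    using antiperiodic_iterate[of f c, OF anti] assms(4) by simp
  finally show ?thesis by simp
qed

text \<open>Let \<open>m\<close> be an inverse of \<open>c\<close> modulo \<open>n\<close>. It is
  odd because \<open>n\<close> is even, so a shift by 1 amounts to an odd number of shifts by
  \<open>c\<close>.\<close>

lemma antiperiodic_1:
  fixes f :: "int \<Rightarrow> real"
  assumes per: "\<And>j k. f (j + k * int n) = f j" and anti: "\<And>j. f (j + int c) = - f j"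
    and n: "even n" "n > 0" and cop: "coprime n c"
  shows "f (j + 1) = - f j"
proof -
  have "\<exists>m. [c * m = 1] (mod n)" using cong_solve_coprime_nat[of c n] cop
    by (simp add: coprime_commute)
  then obtain m where m: "[c * m = 1] (mod n)" by blast
  then have "odd (c * m)" using n
    by (metis cong_dvd_iff cong_dvd_modulus_nat odd_one)
  from m have "[int m * int c = 1] (mod int n)"
    by (metis cong_int_iff mult.commute of_nat_1 of_nat_mult)
  then obtain k where k: "int m * int c = 1 + k * int n"
    by (metis add.commute cong_iff_lin cong_sym mult.commute)
  have "f (j + 1) = f ((j + 1) + k * int n)" by (simp only: per)
  also have "\<dots> = f (j + int m * int c)" by (simp only: k add.assoc)
  also have "\<dots> = - f j"
    using antiperiodic_iterate[of f "int c", OF anti] \<open>odd (c * m)\<close> by simp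
  finally show ?thesis .
qed

lemma antiperiodic_1_of_nat:
  fixes f :: "int \<Rightarrow> real"
  assumes "\<And>j. f (j + 1) = - f j"
  shows "f (j + int m) = (-1) ^ m * f j"
  using antiperiodic_iterate[of f 1, OF assms] by simp

text \<open>If \<open>n div gcd n c\<close> were odd, the whole power of 2 in \<open>n\<close> would
  lie in \<open>gcd n c\<close> and hence divide \<open>c\<close>.\<close>

lemma even_div_gcd:
  fixes n c :: nat
  assumes n: "n = \<beta> * 2 ^ \<alpha>" "odd \<beta>" and ndvd: "\<not> 2 ^ \<alpha> dvd c"
  shows "even (n div gcd n c)"
proof (rule ccontr)
  assume "odd (n div gcd n c)"
  then have "coprime (2 ^ \<alpha>) (n div gcd n c)" by simp
  moreover have "2 ^ \<alpha> dvd gcd n c * (n div gcd n c)" using n by simp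
  ultimately have "2 ^ \<alpha> dvd gcd n c" using coprime_dvd_mult_left_iff by blast
  then show False using ndvd by auto
qed

section \<open>A basis of the antiperiodic sequences\<close>

text \<open>The indicator of the residue class \<open>r\<close> modulo \<open>g\<close>, with a sign
  that alternates from one block of length \<open>g\<close> to the next: the extension of a unit
  vector on \<open>{0..<g}\<close> that changes sign under a shift by \<open>g\<close>.\<close>

definition block_wave :: "nat \<Rightarrow> nat \<Rightarrow> int \<Rightarrow> real" where
  "block_wave g r j = (if j mod int g = int r then (if even (j div int g) then 1 else -1) else 0)"

lemma block_wave_shift:
  assumes "g > 0"
  shows "block_wave g r (j + k * int g) = (if even k then 1 else -1) * block_wave g r j"
  using assms by (simp add: block_wave_def)

lemma block_wave_of_nat: "i < g \<Longrightarrow> block_wave g r (int i) = (if i = r then 1 else 0)"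
  by (simp add: block_wave_def)

text \<open>\<open>n\<close> consists of an even number of blocks, so the signs agree after one turn
  around the cycle.\<close>

lemma block_wave_periodic:
  assumes "even (n div gcd n c)" "n > 0"
  shows "block_wave (gcd n c) r (j + k * int n) = block_wave (gcd n c) r j"
proof -
  have "int n = int (n div gcd n c) * int (gcd n c)"
    by (metis dvd_div_mult_self gcd_dvd1 of_nat_mult)
  then have kn: "k * int n = (k * int (n div gcd n c)) * int (gcd n c)" by (simp only: mult.assoc)
  show ?thesis unfolding kn by (subst block_wave_shift) (use assms in auto)
qed

text \<open>\<open>c div gcd n c\<close> is coprime to the even number \<open>n div gcd n c\<close>,
  hence odd: a shift by \<open>c\<close> crosses an odd number of blocks.\<close>

lemma block_wave_antiperiodic:
  assumes "even (n div gcd n c)" "n > 0"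
  shows "block_wave (gcd n c) r (j + int c) = - block_wave (gcd n c) r j"
proof -
  have "coprime (n div gcd n c) (c div gcd n c)"
    using assms(2) by (intro div_gcd_coprime) simp
  then have odd: "odd (c div gcd n c)" using assms(1) by auto
  have c: "int c = int (c div gcd n c) * int (gcd n c)"
    by (metis dvd_div_mult_self gcd_dvd2 of_nat_mult)
  have "block_wave (gcd n c) r (j + int (c div gcd n c) * int (gcd n c)) =
      - block_wave (gcd n c) r j"
    by (subst block_wave_shift) (use assms(2) odd in auto)
  then show ?thesis by (simp only: c[symmetric])
qed

definition waves :: "nat \<Rightarrow> nat \<Rightarrow> real vec set" where
  "waves n g = (\<lambda>r. vec n (\<lambda>i. block_wave g r (int i))) ` {..<g}"

lemma waves_carrier: "finite (waves n g)" "waves n g \<subseteq> carrier_vec n"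
  by (auto simp: waves_def)

lemma waves_1: "waves n 1 = {vec n (\<lambda>i. (-1) ^ i)}"
  by (auto simp: waves_def block_wave_def lessThan_Suc intro!: eq_vecI)

lemma inj_on_waves:
  assumes "g \<le> n"
  shows "inj_on (\<lambda>r. vec n (\<lambda>i. block_wave g r (int i))) {..<g}" (is "inj_on ?w _")
proof (rule inj_onI)
  fix r s assume rs: "r \<in> {..<g}" "s \<in> {..<g}" and eq: "?w r = ?w s"
  have "?w r $ r = ?w s $ r" by (simp only: eq)
  then show "r = s" using rs assms by (simp add: block_wave_of_nat split: if_splits)
qed

lemma card_waves: "g \<le> n \<Longrightarrow> card (waves n g) = g"
  unfolding waves_def by (simp add: card_image[OF inj_on_waves])

text \<open>On the first \<open>g\<close> coordinates the waves are the unit vectors, so coordinate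
  \<open>r\<close> is private to wave \<open>r\<close>.\<close>

lemma waves_lin_indpt:
  assumes "g \<le> n"
  shows "\<not> LinearCombinations.module.lin_dep class_ring (module_vec TYPE(real) n) (waves n g)"
proof -
  interpret vec_space "TYPE(real)" n .
  show ?thesis
  proof (rule lin_indpt_if_private_index[OF waves_carrier])
    fix v assume "v \<in> waves n g"
    then obtain r where r: "r < g" "v = vec n (\<lambda>i. block_wave g r (int i))"
      by (auto simp: waves_def)
    have "w = v" if "w \<in> waves n g" "w $ r \<noteq> 0" for w
      using that r assms by (auto simp: waves_def block_wave_of_nat split: if_splits)
    then show "\<exists>i<n. v $ i \<noteq> 0 \<and> (\<forall>w\<in>waves n g - {v}. w $ i = 0)"
      using r assms by (intro exI[of _ r]) (auto simp: block_wave_of_nat)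
  qed
qed

text \<open>Such a vector is determined by its first \<open>g\<close> entries, and these are its
  coefficients with respect to the waves.\<close>

lemma antiperiodic_in_span_waves:
  assumes v: "v \<in> carrier_vec n" and g: "0 < g" "g \<le> n"
    and anti: "\<And>j. periodic_ext n v (j + int g) = - periodic_ext n v j"
  shows "v \<in> span_vec n (waves n g)"
proof -
  interpret vec_space "TYPE(real)" n .
  let ?w = "\<lambda>r. vec n (\<lambda>i. block_wave g r (int i))"
  have v_eq: "v $ i = (\<Sum>r<g. v $ r * block_wave g r (int i))" if i: "i < n" for i
  proof -
    have "v $ i = periodic_ext n v (int (i mod g) + int (i div g) * int g)"
      using periodic_ext_of_nat[OF i, of v] by (metis mod_mult_div_eq mult.commute of_nat_add of_nat_mult)
    also have "\<dots> = (-1) ^ (i div g) * periodic_ext n v (int (i mod g))"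
      by (rule antiperiodic_iterate[of "periodic_ext n v" "int g", OF anti])
    also have "periodic_ext n v (int (i mod g)) = v $ (i mod g)"
      using g by (intro periodic_ext_of_nat) (meson le_trans less_le_trans mod_less_divisor)
    also have "(-1) ^ (i div g) * v $ (i mod g) =
        (\<Sum>r<g. if r = i mod g then v $ r * (-1) ^ (i div g) else 0)"
      using g by simp
    also have "\<dots> = (\<Sum>r<g. v $ r * block_wave g r (int i))"
      by (intro sum.cong) (auto simp: block_wave_def uminus_power_if
          simp flip: of_nat_mod of_nat_div)
    finally show ?thesis .
  qed
  show ?thesis
  proof (rule in_spanI[OF waves_carrier v])
    fix i assume i: "i < n"
    \<comment> \<open>A linear combination needs coefficients depending on the vector
      \<open>w\<close>, not on its index \<open>r\<close>. Pairing \<open>w\<close> with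
      \<open>v\<close> over the first \<open>g\<close> coordinates recovers \<open>v $ r\<close>,
      since there wave \<open>r\<close> is a unit vector.\<close>
    have coeff: "(\<Sum>s<g. v $ s * ?w r $ s) = v $ r" if "r < g" for r
    proof -
      have "(\<Sum>s<g. v $ s * ?w r $ s) = (\<Sum>s<g. if s = r then v $ s else 0)"
        using g by (intro sum.cong) (auto simp: block_wave_of_nat)
      then show ?thesis using that by simp
    qed
    have "(\<Sum>w\<in>waves n g. (\<Sum>s<g. v $ s * w $ s) * w $ i) =
        (\<Sum>r<g. (\<Sum>s<g. v $ s * ?w r $ s) * ?w r $ i)"
      unfolding waves_def using sum.reindex[OF inj_on_waves[OF g(2)]] by simp
    also have "\<dots> = v $ i" using coeff v_eq[OF i] i by simp
    finally show "v $ i = (\<Sum>w\<in>waves n g. (\<Sum>s<g. v $ s * w $ s) * w $ i)" by simp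
  qed
qed

section \<open>The null space as a factored difference equation\<close>

locale quartic_circulant =
  fixes n p q :: nat
  assumes p: "1 \<le> p" and pq: "p < q" and qn: "2 * q < n"
begin

lemma n_pos: "n > 0" using qn by simp

lemma adjacency_carrier: "adjacency_matrix (Circ n {p, q}) \<in> carrier_mat n n"
  by (simp add: adjacency_matrix_def Circ_def)

sublocale K: kernel n n "adjacency_matrix (Circ n {p, q})"
  by unfold_locales (rule adjacency_carrier)

text \<open>All four offsets have absolute value below n/2, so two of them differ by less than
  \<open>n\<close>. This is where 4-regularity comes from.\<close>

lemma offsets_distinct:
  assumes "d \<in> {int p, - int p, int q, - int q}" "e \<in> {int p, - int p, int q, - int q}"
    and "[d = e] (mod int n)"
  shows "d = e"
proof -
  have "int n dvd d - e" using assms(3) by (simp add: cong_iff_dvd_diff)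
  moreover have "\<bar>d - e\<bar> < int n" using assms(1,2) p pq qn by auto
  ultimately show ?thesis by (metis dvd_imp_le_int eq_iff_diff_eq_0 linorder_not_le abs_of_nat)
qed

lemma neighbours:
  assumes i: "i < n"
  shows "{k. k < n \<and> (i, k) \<in> parcs (Circ n {p, q})} =
    (\<lambda>d. nat ((int i + d) mod int n)) ` {int p, - int p, int q, - int q}" (is "?N = ?f ` ?D")
proof
  show "?N \<subseteq> ?f ` ?D"
  proof
    fix k assume "k \<in> ?N"
    then have k: "k < n" and "\<exists>s\<in>{p, q}. [int i - int k = int s] (mod int n) \<or>
        [int i - int k = - int s] (mod int n)"
      by (auto simp: Circ_def)
    \<comment> \<open>The set of offsets is closed under negation, so the form \<open>- d\<close>
      covers both alternatives of the adjacency relation.\<close>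
    then obtain d where d: "d \<in> ?D" "[int i - int k = - d] (mod int n)" by force
    then have "int n dvd (int i + d) - int k"
      by (simp add: cong_iff_dvd_diff algebra_simps)
    then have "(int i + d) mod int n = int k mod int n"
      by (simp add: mod_eq_dvd_iff)
    then have "k = ?f d" using k by simp
    then show "k \<in> ?f ` ?D" using d by blast
  qed
next
  show "?f ` ?D \<subseteq> ?N"
  proof
    fix k assume "k \<in> ?f ` ?D"
    then obtain d where d: "d \<in> ?D" and kd: "k = ?f d" by blast
    have k: "k < n" and ik: "int k = (int i + d) mod int n"
      using kd n_pos by (auto simp: nat_less_iff)
    have cong: "[int i - int k = - d] (mod int n)"
    proof -
      have "[int k = int i + d] (mod int n)" by (simp add: ik cong_def)
      then have "[int i - int k = int i - (int i + d)] (mod int n)"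
        by (intro cong_diff cong_refl)
      then show ?thesis by simp
    qed
    have "i \<noteq> k"
    proof
      assume "i = k"
      then have "int n dvd d" using cong by (simp add: cong_iff_dvd_diff)
      moreover have "\<bar>d\<bar> < int n" "d \<noteq> 0" using d p pq qn by auto
      ultimately show False by (metis abs_of_nat dvd_imp_le_int linorder_not_le)
    qed
    then show "k \<in> ?N" using i k d cong by (auto simp: Circ_def)
  qed
qed

text \<open>The four offsets lead to four different columns, so the row sum over neighbours is a sum
  over offsets.\<close>

lemma adjacency_mult_index:
  assumes v: "v \<in> carrier_vec n" and i: "i < n"
  shows "(adjacency_matrix (Circ n {p, q}) *\<^sub>v v) $ i =
    periodic_ext n v (int i + int p) + periodic_ext n v (int i - int p) +
    periodic_ext n v (int i + int q) + periodic_ext n v (int i - int q)"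
proof -
  let ?f = "\<lambda>d. nat ((int i + d) mod int n)" and ?D = "{int p, - int p, int q, - int q}"
  have inj: "inj_on ?f ?D"
  proof (rule inj_onI)
    fix d e assume de: "d \<in> ?D" "e \<in> ?D" "?f d = ?f e"
    have "(int i + d) mod int n = (int i + e) mod int n"
      using de(3) n_pos by (metis eq_nat_nat_iff of_nat_0_less_iff pos_mod_sign)
    then have "[d = e] (mod int n)" by (metis cong_add_lcancel cong_def)
    then show "d = e" using offsets_distinct de(1,2) by blast
  qed
  have "(adjacency_matrix (Circ n {p, q}) *\<^sub>v v) $ i =
      (\<Sum>k\<in>{0..<n}. if (i, k) \<in> parcs (Circ n {p, q}) then v $ k else 0)"
    using v i by (auto simp: adjacency_matrix_def Circ_def scalar_prod_def intro!: sum.cong)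
  also have "\<dots> = (\<Sum>k\<in>{k. k < n \<and> (i, k) \<in> parcs (Circ n {p, q})}. v $ k)"
    by (auto simp: sum.If_cases intro!: sum.cong)
  also have "\<dots> = (\<Sum>d\<in>?D. v $ ?f d)"
    unfolding neighbours[OF i] using sum.reindex[OF inj, of "($) v"] by simp
  also have "\<dots> = (\<Sum>d\<in>?D. periodic_ext n v (int i + d))"
    by (simp add: periodic_ext_def)
  also have "\<dots> = periodic_ext n v (int i + int p) + periodic_ext n v (int i - int p) +
    periodic_ext n v (int i + int q) + periodic_ext n v (int i - int q)"
    using p pq by simp
  finally show ?thesis .
qed

text \<open>The rows give the equation for \<open>0 \<le> j < n\<close>; periodicity extends it to
  all integers.\<close>

lemma null_space_iff:
  "v \<in> null_space (Circ n {p, q}) \<longleftrightarrow> v \<in> carrier_vec n \<and>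
    (\<forall>j. periodic_ext n v (j + int p) + periodic_ext n v (j - int p) +
       periodic_ext n v (j + int q) + periodic_ext n v (j - int q) = 0)"
    (is "_ \<longleftrightarrow> _ \<and> (\<forall>j. ?S j = 0)")
proof (cases "v \<in> carrier_vec n")
  case True
  have "?S j = ?S (int (nat (j mod int n)))" for j
    using n_pos by (simp add: periodic_ext_def mod_simps)
  moreover have "nat (j mod int n) < n" for j
    using n_pos by (simp add: nat_less_iff)
  ultimately have "(\<forall>j. ?S j = 0) \<longleftrightarrow> (\<forall>i<n. ?S (int i) = 0)" by metis
  also have "\<dots> \<longleftrightarrow> (\<forall>i<n. (adjacency_matrix (Circ n {p, q}) *\<^sub>v v) $ i = 0)"
    using adjacency_mult_index[OF True] by simp
  also have "\<dots> \<longleftrightarrow> adjacency_matrix (Circ n {p, q}) *\<^sub>v v = 0\<^sub>v n"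
    using adjacency_carrier by (auto simp: vec_eq_iff)
  finally show ?thesis
    using True by (simp add: null_space_def mat_kernel[OF adjacency_carrier])
qed (simp add: null_space_def mat_kernel[OF adjacency_carrier])

text \<open>Translated by \<open>q\<close>, the equation reads (T^d + 1)(T^c + 1) f = 0, where c + d
  = 2q. Leaving open which of \<open>p + q\<close> and \<open>q - p\<close> is \<open>c\<close> lets
  either factor be applied first.\<close>

lemma null_space_factor:
  assumes cd: "{c, d} = {p + q, q - p}"
  shows "v \<in> null_space (Circ n {p, q}) \<longleftrightarrow> v \<in> carrier_vec n \<and>
    (\<forall>j. periodic_ext n v (j + int d + int c) + periodic_ext n v (j + int d) =
       - (periodic_ext n v (j + int c) + periodic_ext n v j))"
proof -
  let ?f = "periodic_ext n v"
  have "(\<forall>j. ?f (j + int p) + ?f (j - int p) + ?f (j + int q) + ?f (j - int q) = 0) \<longleftrightarrow>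
    (\<forall>j. ?f (j + int q + int p) + ?f (j + int q - int p) + ?f (j + int q + int q) + ?f j = 0)"
    (is "(\<forall>j. ?L j) = (\<forall>j. ?R j)")
  proof -
    have "?R j = ?L (j + int q)" for j by (simp add: add.assoc)
    moreover have "j = (j - int q) + int q" for j by simp
    ultimately show ?thesis by metis
  qed
  also have "\<dots> \<longleftrightarrow> (\<forall>j. ?f (j + int d + int c) + ?f (j + int d) = - (?f (j + int c) + ?f j))"
  proof -
    have "int d + int c = int q + int q" "{int c, int d} = {int q + int p, int q - int p}"
      using cd pq by (auto simp: doubleton_eq_iff)
    then have "?f (j + int d + int c) = ?f (j + int q + int q) \<and>
        ?f (j + int d) + ?f (j + int c) = ?f (j + int q + int p) + ?f (j + int q - int p)" for j
      by (auto simp: doubleton_eq_iff add.assoc add_diff_eq)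
    then show ?thesis by (smt (verit))
  qed
  finally show ?thesis unfolding null_space_iff by blast
qed

text \<open>The waves are annihilated by the factor T^c + 1, hence by the product.\<close>

lemma waves_subset_null_space:
  assumes "c \<in> {p + q, q - p}" and ev: "even (n div gcd n c)"
  shows "waves n (gcd n c) \<subseteq> null_space (Circ n {p, q})"
proof
  fix v assume "v \<in> waves n (gcd n c)"
  then obtain r where r: "v = vec n (\<lambda>i. block_wave (gcd n c) r (int i))"
    by (auto simp: waves_def)
  obtain d where cd: "{c, d} = {p + q, q - p}" using assms(1) by blast
  have "periodic_ext n v j = block_wave (gcd n c) r j" for j
    unfolding r by (rule periodic_ext_vec[OF n_pos]) (rule block_wave_periodic[OF ev n_pos])
  then show "v \<in> null_space (Circ n {p, q})"
    using block_wave_antiperiodic[OF ev n_pos] r by (simp add: null_space_factor[OF cd])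
qed

text \<open>A lower bound from either factor; it is what rules out the non-extremal graphs.\<close>

lemma gcd_le_nullity:
  assumes c: "c \<in> {p + q, q - p}" and ev: "even (n div gcd n c)"
  shows "gcd n c \<le> nullity (Circ n {p, q})"
proof -
  have gn: "gcd n c \<le> n" using n_pos by simp
  have "card (waves n (gcd n c)) \<le> kernel_dim (adjacency_matrix (Circ n {p, q}))"
    using waves_subset_null_space[OF c ev] waves_lin_indpt[OF gn]
    by (intro K.card_le_kernel_dim) (simp_all add: null_space_def)
  then show ?thesis using card_waves[OF gn] by (simp add: nullity_def)
qed

text \<open>The hypothesis \<open>anti\<close> says that the other factor adds nothing to the kernel
  of T^c + 1; the waves are then a basis of the null space.\<close>

lemma null_space_eq_span_waves:
  assumes c: "c \<in> {p + q, q - p}" and ev: "even (n div gcd n c)"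
    and anti: "\<And>v j. v \<in> null_space (Circ n {p, q}) \<Longrightarrow>
      periodic_ext n v (j + int (gcd n c)) = - periodic_ext n v j"
  shows "null_space (Circ n {p, q}) = span_vec n (waves n (gcd n c))"
    and "nullity (Circ n {p, q}) = gcd n c"
proof -
  let ?W = "waves n (gcd n c)"
  have g: "0 < gcd n c" "gcd n c \<le> n" using n_pos by simp_all
  have sub: "?W \<subseteq> mat_kernel (adjacency_matrix (Circ n {p, q}))"
    using waves_subset_null_space[OF c ev] by (simp add: null_space_def)
  have "null_space (Circ n {p, q}) \<subseteq> span_vec n ?W"
    using antiperiodic_in_span_waves[OF _ g] anti null_space_iff by blast
  moreover have "span_vec n ?W \<subseteq> null_space (Circ n {p, q})"
    using K.Ker.span_is_subset2[OF sub] K.span_same[OF sub] by (simp add: null_space_def)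
  ultimately show eq: "null_space (Circ n {p, q}) = span_vec n ?W" by blast
  then have "kernel_dim (adjacency_matrix (Circ n {p, q})) = card ?W"
    using waves_carrier(1) waves_lin_indpt[OF g(2)] sub
    by (intro K.kernel_dim_eq_card) (simp_all add: null_space_def)
  then show "nullity (Circ n {p, q}) = gcd n c"
    using card_waves[OF g(2)] by (simp add: nullity_def)
qed

section \<open>Criteria for nullity 0 and nullity 1\<close>

lemma nullity_eq_0_iff_null_space: "nullity (Circ n {p, q}) = 0 \<longleftrightarrow> null_space (Circ n {p, q}) = {0\<^sub>v n}"
  using K.kernel_dim_eq_0_iff by (simp only: nullity_def null_space_def)

text \<open>If \<open>2 ^ \<alpha>\<close> fails to divide one of the two numbers, that factor
  contributes at least one wave. If it divides both, both factors are injective.\<close>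

lemma nullity_eq_0_iff:
  assumes n: "n = \<beta> * 2 ^ \<alpha>" "odd \<beta>"
  shows "nullity (Circ n {p, q}) = 0 \<longleftrightarrow> 2 ^ \<alpha> dvd p + q \<and> 2 ^ \<alpha> dvd q - p"
proof
  assume "nullity (Circ n {p, q}) = 0"
  then have "2 ^ \<alpha> dvd c" if "c \<in> {p + q, q - p}" for c
    using gcd_le_nullity[OF that] even_div_gcd[OF n, of c] n_pos by fastforce
  then show "2 ^ \<alpha> dvd p + q \<and> 2 ^ \<alpha> dvd q - p" by blast
next
  assume dvd: "2 ^ \<alpha> dvd p + q \<and> 2 ^ \<alpha> dvd q - p"
  have dvd': "(2::int) ^ \<alpha> dvd int (p + q)" "(2::int) ^ \<alpha> dvd int (q - p)"
    using dvd by (metis int_dvd_int_iff of_nat_numeral of_nat_power)+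
  have "v = 0\<^sub>v n" if v: "v \<in> null_space (Circ n {p, q})" for v
  proof -
    let ?f = "periodic_ext n v"
    let ?g = "\<lambda>j. ?f (j + int (p + q)) + ?f j"
    have vc: "v \<in> carrier_vec n"
      and anti: "?g (j + int (q - p)) = - ?g j" for j
      using v null_space_factor[of "p + q" "q - p" v] by auto
    have per: "?g (j + k * int n) = ?g j" for j k
      using periodic_ext_add_mult[of n v "j + int (p + q)" k] by (simp add: algebra_simps)
    \<comment> \<open>The factors are removed one at a time: first T^(q-p) + 1, acting on
      \<open>?g\<close>, then T^(p+q) + 1, acting on \<open>?f\<close>.\<close>
    have "?g j = 0" for j
      by (rule antiperiodic_eq_0[OF per anti n dvd'(2)])
    then have anti': "?f (j + int (p + q)) = - ?f j" for j by (simp add: add_eq_0_iff2)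
    have "?f j = 0" for j
      by (rule antiperiodic_eq_0[OF periodic_ext_add_mult anti' n dvd'(1)])
    then show ?thesis using vc periodic_ext_of_nat[of _ n v] by (intro eq_vecI) auto
  qed
  moreover have "0\<^sub>v n \<in> null_space (Circ n {p, q})"
    using K.kernel_dim_eq_0_iff adjacency_carrier
    by (auto simp: null_space_def mat_kernel[OF adjacency_carrier])
  ultimately show "nullity (Circ n {p, q}) = 0"
    unfolding nullity_eq_0_iff_null_space by blast
qed

text \<open>Sum and difference of \<open>p + q\<close> and \<open>q - p\<close> are
  \<open>2 * q\<close> and \<open>2 * p\<close>, so half of \<open>2 ^ \<alpha>\<close> divides
  \<open>p\<close> and \<open>q\<close>. Divisibility of \<open>p + q\<close> then means equal
  parity of the cofactors, and \<open>\<delta> < \<beta>\<close> is \<open>2 * q < n\<close> after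
  cancellation.\<close>

lemma two_power_dvd_iff:
  assumes n: "n = \<beta> * 2 ^ \<alpha>" and \<alpha>: "\<alpha> \<ge> 1"
  shows "2 ^ \<alpha> dvd p + q \<and> 2 ^ \<alpha> dvd q - p \<longleftrightarrow>
    (\<exists>\<gamma> \<delta>. 1 \<le> \<gamma> \<and> \<gamma> < \<delta> \<and> \<delta> < \<beta> \<and> \<gamma> mod 2 = \<delta> mod 2 \<and>
       p = \<gamma> * 2 ^ (\<alpha> - 1) \<and> q = \<delta> * 2 ^ (\<alpha> - 1))" (is "?L \<longleftrightarrow> ?R")
proof -
  have pow: "2 ^ \<alpha> = 2 * (2::nat) ^ (\<alpha> - 1)" using \<alpha> by (metis One_nat_def Suc_diff_le diff_Suc_Suc diff_zero power_Suc)
  let ?t = "(2::nat) ^ (\<alpha> - 1)"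
  show ?thesis
  proof
    assume L: ?L
    then have "2 ^ \<alpha> dvd (p + q) + (q - p)" "2 ^ \<alpha> dvd (p + q) - (q - p)"
      by (auto intro: dvd_add dvd_diff_nat)
    then have "2 * ?t dvd 2 * q" "2 * ?t dvd 2 * p" using pq by (simp_all add: pow mult_2)
    then obtain \<gamma> \<delta> where gd: "p = ?t * \<gamma>" "q = ?t * \<delta>" by (auto simp: dvd_def)
    have "2 * ?t dvd ?t * (\<gamma> + \<delta>)" using L by (simp add: pow gd distrib_left)
    then have "even (\<gamma> + \<delta>)" by (simp add: mult.commute)
    then have "\<gamma> mod 2 = \<delta> mod 2" by presburger
    moreover have "1 \<le> \<gamma>" using p gd by (cases \<gamma>) auto
    moreover have "\<gamma> < \<delta>" using pq gd by simp
    moreover have "\<delta> < \<beta>" using qn gd n pow by simp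
    ultimately show ?R using gd by (metis mult.commute)
  next
    assume ?R
    then obtain \<gamma> \<delta> where gd: "\<gamma> < \<delta>" "\<gamma> mod 2 = \<delta> mod 2" "p = \<gamma> * ?t" "q = \<delta> * ?t" by blast
    have "even (\<gamma> + \<delta>)" "even (\<delta> - \<gamma>)" using gd(1,2) by presburger+
    moreover have "p + q = (\<gamma> + \<delta>) * ?t" "q - p = (\<delta> - \<gamma>) * ?t"
      using gd by (simp_all add: distrib_right diff_mult_distrib)
    ultimately show ?L unfolding pow by (simp add: mult_dvd_mono)
  qed
qed

text \<open>Here \<open>g = (T\<^sup>p\<^sup>+\<^sup>q + 1) f\<close> alternates, so iterating \<open>f (j + p + q) = g j - f j\<close> around the
  cycle gives \<open>f j = f j - n * g j\<close>: there is no generalized kernel.\<close>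

lemma null_space_antiperiodic_1:
  assumes n: "even n" and a: "gcd n (p + q) = 1" and b: "gcd n (q - p) = 1"
    and v: "v \<in> null_space (Circ n {p, q})"
  shows "periodic_ext n v (j + 1) = - periodic_ext n v j"
proof -
  let ?f = "periodic_ext n v"
  let ?g = "\<lambda>j. ?f (j + int (p + q)) + ?f j"
  have vc: "v \<in> carrier_vec n"
    and anti: "?g (j + int (q - p)) = - ?g j" for j
    using v null_space_factor[of "p + q" "q - p" v] by auto
  have per: "?g (j + k * int n) = ?g j" for j k
    using periodic_ext_add_mult[of n v "j + int (p + q)" k] by (simp add: algebra_simps)
  have cop: "coprime n (p + q)" "coprime n (q - p)" using a b by (simp_all only: coprime_iff_gcd_eq_1)
  have odd: "odd (p + q)" using cop(1) n by auto
  have g1: "?g (j + 1) = - ?g j" for j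
    by (rule antiperiodic_1[OF per anti n n_pos cop(2)])
  \<comment> \<open>As \<open>p + q\<close> is odd, \<open>m * (p + q)\<close> unit shifts produce
    the sign \<open>(-1) ^ m\<close>.\<close>
  have ga: "?g (j + int m * int (p + q)) = (-1) ^ m * ?g j" for j m
    using antiperiodic_1_of_nat[of ?g j "m * (p + q)", OF g1] odd
    by (auto simp: uminus_power_if)
  have iter: "?f (j + int m * int (p + q)) = (-1) ^ m * (?f j - real m * ?g j)" for j m
  proof (induction m)
    case (Suc m)
    have "?f (j + int (Suc m) * int (p + q)) =
        ?f ((j + int m * int (p + q)) + int (p + q))"
      by (simp add: algebra_simps)
    also have "\<dots> = ?g (j + int m * int (p + q)) - ?f (j + int m * int (p + q))" by simp
    also have "\<dots> = (-1) ^ m * ?g j - (-1) ^ m * (?f j - real m * ?g j)"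
      by (subst ga, subst Suc) (rule refl)
    also have "\<dots> = (-1) ^ Suc m * (?f j - real (Suc m) * ?g j)"
      unfolding of_nat_Suc power_Suc by (simp only: algebra_simps)
    finally show ?case .
  qed simp
  have "?g j = 0" for j
  proof -
    have "?f j = ?f (j + int n * int (p + q))"
      using periodic_ext_add_mult[of n v j "int (p + q)"] by (simp only: mult.commute)
    also have "\<dots> = ?f j - real n * ?g j" unfolding iter using n by simp
    finally show ?thesis using n_pos by simp
  qed
  then have anti': "?f (j + int (p + q)) = - ?f j" for j by (simp add: add_eq_0_iff2)
  show ?thesis
    by (rule antiperiodic_1[OF periodic_ext_add_mult anti' n n_pos cop(1)])
qed

text \<open>For gcd 1 there is a single wave, with blocks of length 1: the alternating
  vector.\<close>

lemma null_space_alternating: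
  assumes "even n" "gcd n (p + q) = 1" "gcd n (q - p) = 1"
  shows "null_space (Circ n {p, q}) = span_vec n {vec n (\<lambda>i. (-1) ^ i)}"
    and "nullity (Circ n {p, q}) = 1"
  using null_space_eq_span_waves[of "p + q"] null_space_antiperiodic_1[OF assms] assms(1)
  unfolding assms(2) waves_1 by simp_all

text \<open>Nullity 1 excludes that \<open>2 ^ \<alpha>\<close> divides both \<open>p + q\<close>
  and \<open>q - p\<close>. One that it does not divide has gcd 1 with \<open>n\<close> by the lower
  bound, hence is odd; the other has the same parity, so the same bound applies to it.\<close>

lemma nullity_eq_1_iff:
  assumes n: "n = \<beta> * 2 ^ \<alpha>" "\<beta> \<in> {1, 3}" and \<alpha>: "\<alpha> \<ge> 1"
  shows "nullity (Circ n {p, q}) = 1 \<longleftrightarrow>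
    p mod 2 \<noteq> q mod 2 \<and> gcd n (p + q) = 1 \<and> gcd n (q - p) = 1" (is "?L \<longleftrightarrow> ?R")
proof
  have even: "even n" using n \<alpha> by auto
  assume ?R
  then show ?L using null_space_alternating(2)[OF even] by simp
next
  assume L: ?L
  have odd: "odd \<beta>" and even: "even n" using n \<alpha> by auto
  have gcd1: "gcd n c = 1" if c: "c \<in> {p + q, q - p}" "\<not> 2 ^ \<alpha> dvd c" for c
  proof -
    have "gcd n c \<le> 1" using gcd_le_nullity[OF c(1) even_div_gcd[OF n(1) odd c(2)]] L by simp
    then show ?thesis using n_pos by (simp add: le_Suc_eq)
  qed
  have odd_if: "odd c" if "gcd n c = 1" for c
  proof
    assume "even c"
    then have "2 dvd gcd n c" using even by (rule gcd_greatest[rotated])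
    then show False using that by simp
  qed
  have "2 dvd (2::nat) ^ \<alpha>" using \<alpha> by simp
  then have ndvd_if: "\<not> 2 ^ \<alpha> dvd c" if "odd c" for c :: nat
    using that dvd_trans by blast
  have par: "odd (p + q) \<longleftrightarrow> odd (q - p)" using pq by auto
  have "\<not> (2 ^ \<alpha> dvd p + q \<and> 2 ^ \<alpha> dvd q - p)"
    using nullity_eq_0_iff[OF n(1) odd] L by simp
  then have odds: "odd (p + q)" "odd (q - p)" using gcd1 odd_if par by blast+
  have "gcd n (p + q) = 1" "gcd n (q - p) = 1" using gcd1 ndvd_if odds by blast+
  moreover have "p mod 2 \<noteq> q mod 2" using odds(1) by presburger
  ultimately show ?R by blast
qed

text \<open>Nullity 0 would require \<open>1 \<le> \<gamma> < \<delta> < \<beta>\<close> of equal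
  parity, hence \<open>\<beta> > 3\<close>.\<close>

lemma nullity_pos:
  assumes n: "n = \<beta> * 2 ^ \<alpha>" "\<beta> \<in> {1, 3}" and \<alpha>: "\<alpha> \<ge> 1"
  shows "nullity (Circ n {p, q}) \<ge> 1"
proof -
  have "\<not> (1 \<le> \<gamma> \<and> \<gamma> < \<delta> \<and> \<delta> < \<beta> \<and> \<gamma> mod 2 = \<delta> mod 2)" for \<gamma> \<delta>
    using n(2) by auto presburger
  then have "nullity (Circ n {p, q}) \<noteq> 0"
    using nullity_eq_0_iff[OF n(1)] two_power_dvd_iff[OF n(1) \<alpha>] n(2) by force
  then show ?thesis by simp
qed

end

section \<open>The minimum, and the exceptional order 6\<close>

lemma min_nullity_eqI:
  assumes "quartic_circulant n p q" "nullity (Circ n {p, q}) = m"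
    and "\<And>p q. quartic_circulant n p q \<Longrightarrow> m \<le> nullity (Circ n {p, q})"
  shows "min_nullity n = m"
  unfolding min_nullity_def
proof (rule Min_eqI)
  show "finite (nullity ` quartic_circulants n)" by (simp add: finite_quartic_circulants)
  show "m \<in> nullity ` quartic_circulants n"
    using assms(1,2) unfolding quartic_circulants_def quartic_circulant_def by blast
qed (use assms(3) in \<open>auto simp: quartic_circulants_def quartic_circulant_def\<close>)

lemma waves_6_3:
  "waves 6 3 = {vec_of_list [1, 0, 0, -1, 0, 0], vec_of_list [0, 1, 0, 0, -1, 0],
                vec_of_list [0, 0, 1, 0, 0, -1]}"
proof -
  have "vec 6 (\<lambda>i. block_wave 3 r (int i)) =
      vec_of_list (map (\<lambda>i. block_wave 3 r (int i)) [0, 1, 2, 3, 4, 5])" (is "_ = ?v") for r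
  proof (rule eq_vecI)
    fix i assume "i < dim_vec ?v"
    then have "i = 0 \<or> i = 1 \<or> i = 2 \<or> i = 3 \<or> i = 4 \<or> i = 5" by auto
    then show "vec 6 (\<lambda>i. block_wave 3 r (int i)) $ i = ?v $ i"
      by (elim disjE) (simp_all add: vec_index_vCons)
  qed simp
  moreover have "{..<3} = {0, 1, 2::nat}" by auto
  ultimately show ?thesis by (simp add: waves_def block_wave_def)
qed

text \<open>The factors are T^3 + 1 and T + 1. The sequence g = (T^3 + 1) f is fixed by T^3 because
  T^6 = 1, and negated by T^3 because T g = -g. So g = 0, and the null space is the kernel of T^3 +
  1 alone.\<close>

lemma null_space_Circ_6:
  "null_space (Circ 6 {1, 2}) = span_vec 6 (waves 6 3)" "nullity (Circ 6 {1, 2}) = 3"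
proof -
  interpret quartic_circulant 6 1 2 by unfold_locales auto
  have gcd: "gcd 6 (1 + 2) = (3::nat)" by (simp add: gcd_non_0_nat)
  have anti: "periodic_ext 6 v (j + int 3) = - periodic_ext 6 v j"
    if v: "v \<in> null_space (Circ 6 {1, 2})" for v j
  proof -
    let ?g = "\<lambda>j. periodic_ext 6 v (j + 3) + periodic_ext 6 v j"
    have g1: "?g (j + 1) = - ?g j" for j
      using v null_space_factor[of "1 + 2" "2 - 1" v] by auto
    have "?g (j + 3) = - ?g j"
      using antiperiodic_1_of_nat[of ?g j 3, OF g1] by simp
    moreover have "?g (j + 3) = ?g j"
      using periodic_ext_add_mult[of 6 v j 1] by (simp add: add.assoc)
    ultimately show ?thesis by simp
  qed
  show "null_space (Circ 6 {1, 2}) = span_vec 6 (waves 6 3)" "nullity (Circ 6 {1, 2}) = 3"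
    using null_space_eq_span_waves[of "1 + 2"] anti unfolding gcd by simp_all
qed

lemma quartic_circulants_6: "quartic_circulants 6 = {Circ 6 {1, 2}}"
proof -
  have "1 \<le> p \<and> p < q \<and> 2 * q < 6 \<longleftrightarrow> p = 1 \<and> q = 2" for p q :: nat by auto
  then show ?thesis unfolding quartic_circulants_def by simp
qed

section \<open>The four cases and their extremal graphs\<close>

theorem theorem8:
  fixes n :: nat
  assumes "n \<ge> 5"
  shows
    "(odd n \<longrightarrow>
        min_nullity n = 0 \<and>
        (\<forall>p q :: nat. 1 \<le> p \<and> p < q \<and> 2 * q < n \<longrightarrow>
           nullity (Circ n {p, q}) = min_nullity n \<and>
           null_space (Circ n {p, q}) = {0\<^sub>v n}))
     \<and>
     (n = 6 \<longrightarrow>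
        min_nullity n = 3 \<and>
        nullity (Circ n {1, 2}) = min_nullity n \<and>
        quartic_circulants n = {Circ n {1, 2}} \<and>
        null_space (Circ n {1, 2}) =
          span_vec n {vec_of_list [1, 0, 0, -1, 0, 0],
                      vec_of_list [0, 1, 0, 0, -1, 0],
                      vec_of_list [0, 0, 1, 0, 0, -1]})
     \<and>
     ((\<exists>\<alpha>::nat. \<alpha> \<ge> 3 \<and> n = 2 ^ \<alpha>) \<or> (\<exists>\<alpha>::nat. \<alpha> \<ge> 2 \<and> n = 3 * 2 ^ \<alpha>) \<longrightarrow>
        min_nullity n = 1 \<and>
        (\<forall>p q :: nat. 1 \<le> p \<and> p < q \<and> 2 * q < n \<longrightarrow>
           (nullity (Circ n {p, q}) = min_nullity n \<longleftrightarrow>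
              p mod 2 \<noteq> q mod 2 \<and> gcd n (p + q) = 1 \<and> gcd n (q - p) = 1) \<and>
           (nullity (Circ n {p, q}) = min_nullity n \<longrightarrow>
              null_space (Circ n {p, q}) = span_vec n {vec n (\<lambda>i. (-1) ^ i)})))
     \<and>
     (\<forall>\<alpha> \<beta> :: nat. \<alpha> \<ge> 1 \<and> \<beta> \<ge> 5 \<and> odd \<beta> \<and> n = \<beta> * 2 ^ \<alpha> \<longrightarrow>
        min_nullity n = 0 \<and>
        (\<forall>p q :: nat. 1 \<le> p \<and> p < q \<and> 2 * q < n \<longrightarrow>
           (nullity (Circ n {p, q}) = min_nullity n \<longleftrightarrow>
              (\<exists>\<gamma> \<delta> :: nat. 1 \<le> \<gamma> \<and> \<gamma> < \<delta> \<and> \<delta> < \<beta> \<and> \<gamma> mod 2 = \<delta> mod 2 \<and>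
                 p = \<gamma> * 2 ^ (\<alpha> - 1) \<and> q = \<delta> * 2 ^ (\<alpha> - 1))) \<and>
           (nullity (Circ n {p, q}) = min_nullity n \<longrightarrow>
              null_space (Circ n {p, q}) = {0\<^sub>v n})))"
proof (rule conjI[OF _ conjI[OF _ conjI]], goal_cases)
  case 1
  show ?case
  proof (intro impI)
    assume odd: "odd n"
    \<comment> \<open>For odd \<open>n\<close> the power of 2 is \<open>2 ^ 0\<close>, which divides
      everything.\<close>
    have zero: "nullity (Circ n {p, q}) = 0" if "quartic_circulant n p q" for p q
      using quartic_circulant.nullity_eq_0_iff[OF that, of n 0] odd by simp
    have "quartic_circulant n 1 2" using assms by unfold_locales auto
    then have "min_nullity n = 0" using zero by (intro min_nullity_eqI) auto
    then show "min_nullity n = 0 \<and> (\<forall>p q. 1 \<le> p \<and> p < q \<and> 2 * q < n \<longrightarrow>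
        nullity (Circ n {p, q}) = min_nullity n \<and> null_space (Circ n {p, q}) = {0\<^sub>v n})"
      using zero quartic_circulant.nullity_eq_0_iff_null_space
      by (simp add: quartic_circulant_def)
  qed
next
  case 2
  have "min_nullity 6 = 3"
    using null_space_Circ_6(2) by (simp add: min_nullity_def quartic_circulants_6)
  then show ?case
    using null_space_Circ_6 quartic_circulants_6 waves_6_3 by auto
next
  case 3
  show ?case
  proof (intro impI)
    assume "(\<exists>\<alpha>::nat. \<alpha> \<ge> 3 \<and> n = 2 ^ \<alpha>) \<or> (\<exists>\<alpha>::nat. \<alpha> \<ge> 2 \<and> n = 3 * 2 ^ \<alpha>)"
    \<comment> \<open>Both families are treated at once with odd part 1 or 3. The lower bounds on
      the exponent give \<open>n > 6\<close>, which makes the pair 2, 3 admissible.\<close>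
    then have "\<exists>\<alpha> \<beta>. n = \<beta> * 2 ^ \<alpha> \<and> \<beta> \<in> {1, 3} \<and> \<alpha> \<ge> 1 \<and> n > 6"
    proof (elim disjE exE conjE)
      fix \<alpha> :: nat assume \<alpha>: "\<alpha> \<ge> 3" "n = 2 ^ \<alpha>"
      have "(2::nat) ^ 3 \<le> 2 ^ \<alpha>" using \<alpha>(1) by (intro power_increasing) auto
      then show ?thesis using \<alpha> by (intro exI[of _ \<alpha>] exI[of _ 1]) auto
    next
      fix \<alpha> :: nat assume \<alpha>: "\<alpha> \<ge> 2" "n = 3 * 2 ^ \<alpha>"
      have "(2::nat) ^ 2 \<le> 2 ^ \<alpha>" using \<alpha>(1) by (intro power_increasing) auto
      then show ?thesis using \<alpha> by (intro exI[of _ \<alpha>] exI[of _ 3]) auto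
    qed
    then obtain \<alpha> \<beta> where n: "n = \<beta> * 2 ^ \<alpha>" "\<beta> \<in> {1, 3}" and \<alpha>: "\<alpha> \<ge> 1" and n6: "n > 6"
      by blast
    note iff = quartic_circulant.nullity_eq_1_iff[OF _ n \<alpha>]
    \<comment> \<open>The witness has difference 1 and sum 5, both coprime to \<open>n\<close>,
      whose prime factors are among 2 and 3.\<close>
    have Q: "quartic_circulant n 2 3" using n6 by unfold_locales auto
    have "coprime \<beta> 5" using n(2) by (auto simp: coprime_iff_gcd_eq_1 gcd_non_0_nat)
    moreover have "coprime (2 ^ \<alpha>) (5::nat)"
      by (metis coprime_left_2_iff_odd coprime_power_left_iff odd_numeral)
    ultimately have "gcd n 5 = 1" unfolding n(1) coprime_iff_gcd_eq_1[symmetric] by simp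
    then have "nullity (Circ n {2, 3}) = 1" using iff[OF Q] by simp
    then have min: "min_nullity n = 1"
      using quartic_circulant.nullity_pos[OF _ n \<alpha>] by (intro min_nullity_eqI[OF Q]) auto
    have even: "even n" using n \<alpha> by auto
    show "min_nullity n = 1 \<and> (\<forall>p q. 1 \<le> p \<and> p < q \<and> 2 * q < n \<longrightarrow>
        (nullity (Circ n {p, q}) = min_nullity n \<longleftrightarrow>
           p mod 2 \<noteq> q mod 2 \<and> gcd n (p + q) = 1 \<and> gcd n (q - p) = 1) \<and>
        (nullity (Circ n {p, q}) = min_nullity n \<longrightarrow>
           null_space (Circ n {p, q}) = span_vec n {vec n (\<lambda>i. (-1) ^ i)}))"
      unfolding min
    proof (intro conjI allI impI refl)
      fix p q assume "1 \<le> p \<and> p < q \<and> 2 * q < n"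
      then have pq: "quartic_circulant n p q" by unfold_locales auto
      show eq: "nullity (Circ n {p, q}) = 1 \<longleftrightarrow>
          p mod 2 \<noteq> q mod 2 \<and> gcd n (p + q) = 1 \<and> gcd n (q - p) = 1"
        by (rule iff[OF pq])
      assume "nullity (Circ n {p, q}) = 1"
      then show "null_space (Circ n {p, q}) = span_vec n {vec n (\<lambda>i. (-1) ^ i)}"
        using quartic_circulant.null_space_alternating(1)[OF pq even] eq by blast
    qed
  qed
next
  case 4
  show ?case
  proof (intro allI impI, elim conjE)
    fix \<alpha> \<beta> :: nat
    assume \<alpha>: "\<alpha> \<ge> 1" and \<beta>: "\<beta> \<ge> 5" "odd \<beta>" and n: "n = \<beta> * 2 ^ \<alpha>"
    let ?t = "(2::nat) ^ (\<alpha> - 1)"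
    have iff: "nullity (Circ n {p, q}) = 0 \<longleftrightarrow>
        (\<exists>\<gamma> \<delta>. 1 \<le> \<gamma> \<and> \<gamma> < \<delta> \<and> \<delta> < \<beta> \<and> \<gamma> mod 2 = \<delta> mod 2 \<and> p = \<gamma> * ?t \<and> q = \<delta> * ?t)"
      if "quartic_circulant n p q" for p q
      using quartic_circulant.nullity_eq_0_iff[OF that n \<beta>(2)]
        quartic_circulant.two_power_dvd_iff[OF that n \<alpha>] by simp
    \<comment> \<open>The witness takes \<open>\<gamma> = 1\<close> and \<open>\<delta> = 3\<close>,
      the smallest pair of equal parity; it fits because
      \<open>6 * ?t < 10 * ?t \<le> n\<close>.\<close>
    have "2 ^ \<alpha> = 2 * ?t" using \<alpha> by (cases \<alpha>) auto
    then have "n = \<beta> * (2 * ?t)" using n by simp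
    moreover have "5 * (2 * ?t) \<le> \<beta> * (2 * ?t)" using \<beta>(1) by (rule mult_le_mono1)
    moreover have "?t > 0" by simp
    ultimately have "1 * ?t \<ge> 1 \<and> 1 * ?t < 3 * ?t \<and> 2 * (3 * ?t) < n" by linarith
    then have Q: "quartic_circulant n (1 * ?t) (3 * ?t)" by unfold_locales auto
    have "nullity (Circ n {1 * ?t, 3 * ?t}) = 0"
      unfolding iff[OF Q] using \<beta>(1) by (intro exI[of _ 1] exI[of _ 3]) auto
    then have min: "min_nullity n = 0" by (intro min_nullity_eqI[OF Q]) auto
    show "min_nullity n = 0 \<and> (\<forall>p q. 1 \<le> p \<and> p < q \<and> 2 * q < n \<longrightarrow>
        (nullity (Circ n {p, q}) = min_nullity n \<longleftrightarrow>
           (\<exists>\<gamma> \<delta>. 1 \<le> \<gamma> \<and> \<gamma> < \<delta> \<and> \<delta> < \<beta> \<and> \<gamma> mod 2 = \<delta> mod 2 \<and> p = \<gamma> * ?t \<and> q = \<delta> * ?t)) \<and>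
        (nullity (Circ n {p, q}) = min_nullity n \<longrightarrow> null_space (Circ n {p, q}) = {0\<^sub>v n}))"
      unfolding min
    proof (intro conjI[OF refl] allI impI)
      fix p q assume "1 \<le> p \<and> p < q \<and> 2 * q < n"
      then have pq: "quartic_circulant n p q" by unfold_locales auto
      show "(nullity (Circ n {p, q}) = 0 \<longleftrightarrow>
           (\<exists>\<gamma> \<delta>. 1 \<le> \<gamma> \<and> \<gamma> < \<delta> \<and> \<delta> < \<beta> \<and> \<gamma> mod 2 = \<delta> mod 2 \<and> p = \<gamma> * ?t \<and> q = \<delta> * ?t)) \<and>
        (nullity (Circ n {p, q}) = 0 \<longrightarrow> null_space (Circ n {p, q}) = {0\<^sub>v n})"
        using iff[OF pq] quartic_circulant.nullity_eq_0_iff_null_space[OF pq] by blast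
    qed
  qed
qed

end
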